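(* Let $X$ be a compact Hausdorff space whose weight $w(X)$ is a regular (infinite) cardinal and such that one of the following conditions holds: (1) $X$ is homogeneous; (2) $X$ is hereditarily normal; (3) $\beta\omega$ (the Čech–Stone compactification of the countable discrete space) does not embed in $X$; (4) $|X|<2^{w(X)}$. Then $\delta\mathrm{Nt}(X)=\mathrm{Nt}(X)$.
   Context: For a cardinal $\kappa$, a family $\mathcal B$ of sets is called $\kappa^{\mathrm{op}}$-like if for every $U\in\mathcal B$ the set $\{V\in\mathcal B: U\subseteq V\}$ has cardinality $<\kappa$. The Noetherian type $\mathrm{Nt}(X)$ of a topological space $X$ is the least infinite cardinal $\kappa$ such that $X$ has a base which is $\kappa^{\mathrm{op}}$-like. Define $\delta\mathrm{Nt}(X)=\sup\{\mathrm{Nt}(D): D \text{ is a dense subspace of } X\}$. The weight $w(X)$ is the least cardinality of a base of $X$. A space is homogeneous if for all points $p,q$ there is a self-homeomorphism taking $p$ to $q$. *)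

theory Defs
  imports "HOL-Analysis.Analysis"
begin

unbundle cardinal_syntax
no_notation elt_set_eq (infix "=o" 50)

section \<open>Least cardinals with a given property\<close>

text \<open>Cardinals are relations \<open>\<kappa>\<close> with \<^term>\<open>Card_order \<kappa>\<close>, considered up to \<open>=o\<close>.
  The minimum is taken among the cardinals living on the type \<open>'k\<close>; as every cardinal below
  one on \<open>'k\<close> has a copy on \<open>'k\<close>, this is the true minimum as soon as some cardinal
  on \<open>'k\<close> has the property.\<close>

definition least_card :: "('k rel \<Rightarrow> bool) \<Rightarrow> 'k rel" where
  "least_card P = (SOME \<kappa>. Card_order \<kappa> \<and> P \<kappa> \<and> (\<forall>\<mu>. Card_order \<mu> \<and> P \<mu> \<longrightarrow> \<kappa> \<le>o \<mu>))"

definition card_Sup :: "'k rel set \<Rightarrow> 'k rel" where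
  "card_Sup K = least_card (\<lambda>\<kappa>. \<forall>\<mu>\<in>K. \<mu> \<le>o \<kappa>)"

lemma least_card:
  assumes "Card_order \<mu>" "P \<mu>"
  shows "Card_order (least_card P)" and "P (least_card P)" and "least_card P \<le>o \<mu>"
proof -
  have "\<exists>\<kappa>\<in>{\<kappa>. Card_order \<kappa> \<and> P \<kappa>}. \<forall>\<mu>\<in>{\<kappa>. Card_order \<kappa> \<and> P \<kappa>}. \<kappa> \<le>o \<mu>"
    using assms by (intro exists_minim_Card_order) auto
  then have "\<exists>\<kappa>. Card_order \<kappa> \<and> P \<kappa> \<and> (\<forall>\<mu>. Card_order \<mu> \<and> P \<mu> \<longrightarrow> \<kappa> \<le>o \<mu>)"
    by blast
  from someI_ex[OF this]
  have *: "Card_order (least_card P) \<and> P (least_card P) \<and>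
      (\<forall>\<mu>. Card_order \<mu> \<and> P \<mu> \<longrightarrow> least_card P \<le>o \<mu>)"
    unfolding least_card_def .
  show "Card_order (least_card P)" "P (least_card P)" "least_card P \<le>o \<mu>"
    using * assms by auto
qed

lemma card_ordLess_copy:
  fixes \<mu> :: "'m rel" and \<kappa> :: "'k rel"
  assumes "Card_order \<mu>" "Card_order \<kappa>" "\<not> \<kappa> \<le>o \<mu>"
  obtains \<nu> :: "'k rel" where "Card_order \<nu>" "\<nu> =o \<mu>" "\<nu> <o \<kappa>"
proof -
  have "\<mu> <o \<kappa>"
    using assms by (meson card_order_on_well_order_on not_ordLess_iff_ordLeq)
  then obtain \<nu> :: "'k rel" where "\<mu> =o \<nu>" "\<nu> <o \<kappa>"
    using internalize_ordLess[of \<mu> \<kappa>] by blast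
  then show thesis
    using that assms(1) Card_order_ordIso2 ordIso_symmetric by blast
qed

lemma card_Sup:
  fixes K :: "'k rel set"
  assumes "\<And>\<mu>. \<mu> \<in> K \<Longrightarrow> Card_order \<mu>"
  shows "Card_order (card_Sup K)"
    and "\<mu> \<in> K \<Longrightarrow> \<mu> \<le>o card_Sup K"
    and "Card_order (\<kappa> :: 'l rel) \<Longrightarrow> (\<And>\<mu>. \<mu> \<in> K \<Longrightarrow> \<mu> \<le>o \<kappa>) \<Longrightarrow> card_Sup K \<le>o \<kappa>"
  proof -
  let ?P = "\<lambda>\<kappa> :: 'k rel. \<forall>\<mu>\<in>K. \<mu> \<le>o \<kappa>"
  have "\<mu> \<le>o |UNIV :: 'k set|" if "\<mu> \<in> K" for \<mu>
    using assms[OF that] using card_of_mono1[OF subset_UNIV, of "Field \<mu>"]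
    by (meson card_of_Field_ordIso ordIso_ordLeq_trans ordIso_symmetric)
  then have P: "Card_order |UNIV :: 'k set|" "?P |UNIV :: 'k set|"
    by (auto simp: card_of_Card_order)
  note least = least_card[where P = ?P, folded card_Sup_def]
  show card: "Card_order (card_Sup K)" and "\<mu> \<in> K \<Longrightarrow> \<mu> \<le>o card_Sup K"
    using least(1,2)[OF P] by auto
  show "card_Sup K \<le>o \<kappa>" if \<kappa>: "Card_order \<kappa>" "\<And>\<mu>. \<mu> \<in> K \<Longrightarrow> \<mu> \<le>o \<kappa>" for \<kappa> :: "'l rel"
  proof (rule ccontr)
    assume "\<not> card_Sup K \<le>o \<kappa>"
    then obtain \<nu> :: "'k rel" where \<nu>: "Card_order \<nu>" "\<nu> =o \<kappa>" "\<nu> <o card_Sup K"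
      using card_ordLess_copy[OF \<kappa>(1) card] by blast
    have "?P \<nu>"
      using \<kappa>(2) ordLeq_ordIso_trans[OF _ ordIso_symmetric[OF \<nu>(2)]] by blast
    then show False
      using least(3)[OF \<nu>(1)] \<nu>(3) not_ordLess_ordLeq by blast
  qed
qed

section \<open>Cardinal functions of topological spaces\<close>

definition is_base :: "'a topology \<Rightarrow> 'a set set \<Rightarrow> bool" where
  "is_base X \<B> \<longleftrightarrow> (\<forall>V\<in>\<B>. openin X V) \<and>
     (\<forall>U x. openin X U \<and> x \<in> U \<longrightarrow> (\<exists>V\<in>\<B>. x \<in> V \<and> V \<subseteq> U))"

definition weight :: "'a topology \<Rightarrow> 'a set rel" where
  "weight X = least_card (\<lambda>\<kappa>. \<exists>\<B>. is_base X \<B> \<and> |\<B>| =o \<kappa>)"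

definition op_like :: "'k rel \<Rightarrow> 'a set set \<Rightarrow> bool" where
  "op_like \<kappa> \<B> \<longleftrightarrow> (\<forall>U\<in>\<B>. |{V\<in>\<B>. U \<subseteq> V}| <o \<kappa>)"

text \<open>A base \<open>\<B>\<close> is \<open>op_like\<close> for every infinite cardinal above \<open>|\<B>|\<close>, and the type
  \<^typ>\<open>('a set + nat) set\<close> always carries such a cardinal, even when \<open>'a\<close> is finite.\<close>

definition Nt :: "'a topology \<Rightarrow> ('a set + nat) set rel" where
  "Nt X = least_card (\<lambda>\<kappa>. cinfinite \<kappa> \<and> (\<exists>\<B>. is_base X \<B> \<and> op_like \<kappa> \<B>))"

definition dense_in :: "'a topology \<Rightarrow> 'a set \<Rightarrow> bool" where
  "dense_in X D \<longleftrightarrow> D \<subseteq> topspace X \<and> X closure_of D = topspace X"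

definition delta_Nt :: "'a topology \<Rightarrow> ('a set + nat) set rel" where
  "delta_Nt X = card_Sup {Nt (subtopology X D) | D. dense_in X D}"

lemma is_base_opens: "is_base X {U. openin X U}"
  unfolding is_base_def by auto

lemma weight:
  shows "Card_order (weight X)"
    and "\<exists>\<B>. is_base X \<B> \<and> |\<B>| =o weight X"
    and "is_base X \<B> \<Longrightarrow> weight X \<le>o |\<B>|"
proof -
  let ?P = "\<lambda>\<kappa>. \<exists>\<B>. is_base X \<B> \<and> |\<B>| =o \<kappa>"
  have P: "Card_order |\<B>| \<and> ?P |\<B>|" if "is_base X \<B>" for \<B>
    using that card_of_Card_order card_of_refl by blast
  show "Card_order (weight X)" "?P (weight X)"
    using least_card[where P = ?P] P[OF is_base_opens] unfolding weight_def by blast+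
  show "weight X \<le>o |\<B>|" if "is_base X \<B>"
    using least_card(3)[where P = ?P] P[OF that] unfolding weight_def by blast
qed

lemma Nt:
  fixes X :: "'a topology"
  shows "Card_order (Nt X)" and "cinfinite (Nt X)"
    and "\<exists>\<B>. is_base X \<B> \<and> op_like (Nt X) \<B>"
    and "Card_order (\<mu> :: 'm rel) \<Longrightarrow> cinfinite \<mu> \<Longrightarrow> is_base X \<B> \<Longrightarrow> op_like \<mu> \<B> \<Longrightarrow> Nt X \<le>o \<mu>"
  proof -
  let ?P = "\<lambda>\<kappa> :: ('a set + nat) set rel. cinfinite \<kappa> \<and> (\<exists>\<B>. is_base X \<B> \<and> op_like \<kappa> \<B>)"
  let ?\<B> = "{U. openin X U}"
  let ?S = "?\<B> <+> (UNIV :: nat set)"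
  let ?\<kappa> = "cardSuc |?S|"
  have inf: "infinite ?S"
    by simp
  have "op_like ?\<kappa> ?\<B>"
    unfolding op_like_def
  proof
    fix U
    have "|{V \<in> ?\<B>. U \<subseteq> V}| \<le>o |?\<B>|"
      by (rule card_of_mono1) auto
    also have "|?\<B>| \<le>o |?S|"
      by (rule card_of_Plus1)
    also have "|?S| <o ?\<kappa>"
      by (rule cardSuc_greater) (rule card_of_Card_order)
    finally show "|{V \<in> ?\<B>. U \<subseteq> V}| <o ?\<kappa>" .
  qed
  moreover have "cinfinite ?\<kappa>"
    using inf cardSuc_finite[OF card_of_Card_order, of ?S] unfolding cinfinite_def Field_card_of by blast
  ultimately have P: "Card_order ?\<kappa>" "?P ?\<kappa>"
    using is_base_opens cardSuc_Card_order[OF card_of_Card_order] by blast+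
  note least = least_card[where P = ?P, folded Nt_def]
  show card: "Card_order (Nt X)" and "cinfinite (Nt X)"
    and "\<exists>\<B>. is_base X \<B> \<and> op_like (Nt X) \<B>"
    using least(1,2)[OF P] by auto
  show "Nt X \<le>o \<mu>"
    if \<mu>: "Card_order \<mu>" "cinfinite \<mu>" "is_base X \<B>" "op_like \<mu> \<B>" for \<mu> :: "'m rel" and \<B>
  proof (rule ccontr)
    assume "\<not> Nt X \<le>o \<mu>"
    then obtain \<nu> :: "('a set + nat) set rel" where \<nu>: "Card_order \<nu>" "\<nu> =o \<mu>" "\<nu> <o Nt X"
      using card_ordLess_copy[OF \<mu>(1) card] by blast
    have "op_like \<nu> \<B>"
      using \<mu>(4) ordLess_ordIso_trans[OF _ ordIso_symmetric[OF \<nu>(2)]] unfolding op_like_def by blast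
    moreover have "cinfinite \<nu>"
      using cinfinite_mono[OF ordIso_imp_ordLeq[OF ordIso_symmetric[OF \<nu>(2)]] \<mu>(2)] .
    ultimately have "?P \<nu>"
      using \<mu>(3) by blast
    then show False
      using least(3)[OF \<nu>(1)] \<nu>(3) not_ordLess_ordLeq by blast
  qed
qed

lemma delta_Nt:
  fixes X :: "'a topology"
  shows "Card_order (delta_Nt X)"
    and "dense_in X D \<Longrightarrow> Nt (subtopology X D) \<le>o delta_Nt X"
    and "Card_order (\<mu> :: 'm rel) \<Longrightarrow> (\<And>D. dense_in X D \<Longrightarrow> Nt (subtopology X D) \<le>o \<mu>)
      \<Longrightarrow> delta_Nt X \<le>o \<mu>"
  proof -
  let ?K = "{Nt (subtopology X D) | D. dense_in X D}"
  have K: "Card_order \<mu>" if "\<mu> \<in> ?K" for \<mu>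
    using that Nt(1) by auto
  show "Card_order (delta_Nt X)"
    unfolding delta_Nt_def by (rule card_Sup(1)) (rule K)
  show "Nt (subtopology X D) \<le>o delta_Nt X" if "dense_in X D"
    unfolding delta_Nt_def by (rule card_Sup(2)) (use K that in blast)+
  show "delta_Nt X \<le>o \<mu>"
    if "Card_order \<mu>" "\<And>D. dense_in X D \<Longrightarrow> Nt (subtopology X D) \<le>o \<mu>" for \<mu> :: "'m rel"
    unfolding delta_Nt_def by (rule card_Sup(3)) (use K that in blast)+
qed

section \<open>Homogeneity and the Stone-Cech compactification\<close>

definition homogeneous_space :: "'a topology \<Rightarrow> bool" where
  "homogeneous_space X \<longleftrightarrow>
     (\<forall>p\<in>topspace X. \<forall>q\<in>topspace X. \<exists>f. homeomorphic_map X X f \<and> f p = q)"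

text \<open>The closure of the image of the evaluation map in the cube \<open>[0,1]\<^sup>C\<close>, where \<open>C\<close>
  is the set of continuous functions into \<open>[0,1]\<close>; these are taken extensional so that
  functions agreeing on the space are identified.\<close>

definition unit_functions :: "'a topology \<Rightarrow> ('a \<Rightarrow> real) set" where
  "unit_functions X =
     {f \<in> extensional (topspace X). continuous_map X (top_of_set {0..1}) f}"

definition stone_cech :: "'a topology \<Rightarrow> (('a \<Rightarrow> real) \<Rightarrow> real) topology" where
  "stone_cech X =
     (let C = unit_functions X; cube = product_topology (\<lambda>f. top_of_set {0..1}) C
      in subtopology cube (cube closure_of ((\<lambda>x. \<lambda>f\<in>C. f x) ` topspace X)))"

definition beta_omega :: "((nat \<Rightarrow> real) \<Rightarrow> real) topology" where
  "beta_omega = stone_cech (discrete_topology UNIV)"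

end

theory Submission
  imports Defs "HOL-Library.Countable_Set_Type"
begin

text \<open>
  The whole space is one of its dense subspaces, so the content is that \<open>Nt D \<le> Nt X\<close> for every
  dense subspace \<open>D\<close>. Traces of a base of \<open>X\<close> form a base of \<open>D\<close>, but an inclusion between traces
  need not come from an inclusion between the sets themselves, so tracing an arbitrary
  \<open>\<kappa>\<close>-op-like base may destroy this property. It does not when the sets are regular open: then
  \<open>R \<inter> D \<subseteq> R' \<inter> D\<close> forces \<open>R \<subseteq> R'\<close> (\<open>regular_open_subset_if_dense_trace\<close>). What has to be shown is that
  a \<open>\<kappa>\<close>-op-like base \<open>\<B>\<close> of a compact Hausdorff space can be replaced by a \<open>\<kappa>\<close>-op-like base of regular
  open sets (\<open>regular_open_op_like_base\<close>).

  The new base shrinks the old one: each new set \<open>R\<close> is assigned some \<open>W \<in> \<B>\<close> with \<open>R \<subseteq> W\<close>, and each \<open>W\<close>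
  is assigned to only finitely many \<open>R\<close>. If \<open>V \<in> \<B>\<close> is a nonempty subset of \<open>R\<close>, then every new set
  above \<open>R\<close> is assigned to one of the fewer than \<open>\<kappa>\<close> members of \<open>\<B>\<close> above \<open>V\<close>; hence there are fewer
  than \<open>\<kappa>\<close> such sets.

  To get a base, one has to cover \<open>closure V\<close> by new sets inside \<open>W\<close> for all \<open>V, W \<in> \<B>\<close> with
  \<open>closure V \<subseteq> W\<close>. By compactness finitely many sets suffice, and a point \<open>p\<close> of \<open>closure V\<close> can be
  served as soon as there is a member \<open>W'\<close> of \<open>\<B>\<close> with \<open>p \<in> W' \<subseteq> W\<close> that has not been used before. This
  could fail only when the members used so far contain a local base at \<open>p\<close>. Suppose that they lie
  in a union of finitely many sets \<open>N\<^sub>1, \<dots>, N\<^sub>k\<close> all of whose pairs have been treated already.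
  Then one \<open>N\<^sub>i\<close> alone contains a local base at \<open>p\<close>, and the pairs of this \<open>N\<^sub>i\<close> have already produced a
  new set around \<open>p\<close> inside \<open>W\<close>. So \<open>p\<close> needs no service (\<open>fresh_member\<close>).

  It remains to order the pairs such that at every moment the used sets lie in finitely many
  completely treated sets, up to a finite remainder. This is an induction on cardinality in the
  manner of Davies trees (\<open>settle\<close>): a countable set of pairs is treated one pair after the other,
  and a set \<open>E\<close> of uncountable size is exhausted by a chain of length \<open>|E|\<close> of smaller sets, where the
  union of the chain so far becomes one additional completely treated set when the induction
  hypothesis is applied to the next member of the chain.
\<close>

section \<open>Regular open sets in regular spaces\<close>

lemma regular_open_between:
  assumes "regular_space X" "openin X W" "p \<in> W"
  obtains R where "openin X R" "X interior_of (X closure_of R) = R" "p \<in> R"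
    "X closure_of R \<subseteq> W"
proof -
  have "closedin X (topspace X - W)" "p \<in> topspace X - (topspace X - W)"
    using assms openin_subset by fastforce+
  then obtain U where U: "openin X U" "p \<in> U" "disjnt (topspace X - W) (X closure_of U)"
    using assms(1) unfolding regular_space by meson
  let ?R = "X interior_of (X closure_of U)"
  have UR: "U \<subseteq> ?R"
    using U(1) by (simp add: interior_of_maximal closure_of_subset openin_subset)
  have RU: "X closure_of ?R \<subseteq> X closure_of U"
    by (simp add: closure_of_minimal interior_of_subset)
  have "X closure_of U \<subseteq> X closure_of ?R"
    using UR by (rule closure_of_mono)
  then have "X interior_of (X closure_of ?R) = ?R"
    using RU by simp
  moreover have "X closure_of U \<subseteq> W"
    using U(3) closure_of_subset_topspace[of X U] unfolding disjnt_def by blast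
  ultimately show thesis
    using that[of ?R] UR U(2) RU by auto
qed

section \<open>End extensions of assignments\<close>

text \<open>An assignment is a relation \<open>S\<close> of pairs \<open>(W, R)\<close>, the new set \<open>R\<close> being assigned to the old set
  \<open>W\<close>. Later stages may add pairs only over old sets \<open>W\<close> that were not used before; this is what
  keeps the fibres finite at limit stages.\<close>

definition extends :: "('b \<times> 'c) set \<Rightarrow> ('b \<times> 'c) set \<Rightarrow> bool" where
  "extends S S' \<longleftrightarrow> S \<subseteq> S' \<and> (\<forall>W\<in>Domain S. S' `` {W} = S `` {W})"

lemma extends_refl [simp]: "extends S S"
  by (simp add: extends_def)

lemma extends_subset: "extends S S' \<Longrightarrow> S \<subseteq> S'"
  by (simp add: extends_def)

lemma extends_trans: "extends S S' \<Longrightarrow> extends S' S'' \<Longrightarrow> extends S S''"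
  unfolding extends_def by blast

lemma extends_Union:
  assumes "\<And>S S'. S \<in> \<C> \<Longrightarrow> S' \<in> \<C> \<Longrightarrow> extends S S' \<or> extends S' S" and "S \<in> \<C>"
  shows "extends S (\<Union>\<C>)"
proof -
  have "(W, R) \<in> S" if "W \<in> Domain S" "(W, R) \<in> S'" "S' \<in> \<C>" for W R S'
    using assms(1)[OF assms(2) that(3)] that(1,2) unfolding extends_def by blast
  then show ?thesis
    using assms(2) unfolding extends_def by blast
qed

text \<open>A family above a common starting point stays a chain when that point is added. The family is
  indexed so that the rule applies to stages of a transfinite recursion.\<close>

lemma extends_chain_insert:
  assumes "\<And>d. d \<in> J \<Longrightarrow> extends S (A d)"
    and "\<And>d d'. d \<in> J \<Longrightarrow> d' \<in> J \<Longrightarrow> extends (A d) (A d') \<or> extends (A d') (A d)"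
    and "U \<in> insert S (A ` J)" "U' \<in> insert S (A ` J)"
  shows "extends U U' \<or> extends U' U"
  using assms by auto

section \<open>Shrinking a base to regular open sets\<close>

locale compact_Hausdorff_base =
  fixes X :: "'a topology" and \<B> :: "'a set set"
  assumes compact: "compact_space X" and Hausdorff: "Hausdorff_space X"
    and base: "is_base X \<B>"
begin

lemma base_open: "V \<in> \<B> \<Longrightarrow> openin X V"
  using base by (simp add: is_base_def)

lemma base_inside:
  assumes "openin X U" "p \<in> U"
  obtains V where "V \<in> \<B>" "p \<in> V" "V \<subseteq> U"
  using assms base unfolding is_base_def by meson

lemma regular: "regular_space X"
  using compact Hausdorff by (simp add: compact_Hausdorff_imp_regular_space)

definition selection :: "('a set \<times> 'a set) set \<Rightarrow> bool" where
  "selection S \<longleftrightarrow> (\<forall>(W, R)\<in>S. W \<in> \<B> \<and> R \<subseteq> W \<and> openin X R \<and>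
     X interior_of (X closure_of R) = R) \<and> (\<forall>W. finite (S `` {W}))"

text \<open>The pair \<open>(V, W)\<close> is handled if the new sets inside \<open>W\<close> cover the closure of \<open>V\<close>. Isolated
  points are exempt: such a point has only one small neighbourhood, so it may run out of fresh
  members of \<open>\<B>\<close>; its singleton is a regular open set anyway and joins the new base at the end.\<close>

definition handled :: "('a set \<times> 'a set) set \<Rightarrow> 'a set \<Rightarrow> 'a set \<Rightarrow> bool" where
  "handled S V W \<longleftrightarrow>
     (\<forall>p\<in>X closure_of V. openin X {p} \<or> (\<exists>R\<in>Range S. p \<in> R \<and> R \<subseteq> W))"

definition settled :: "('a set \<times> 'a set) set \<Rightarrow> 'a set set \<Rightarrow> bool" where
  "settled S N \<longleftrightarrow> (\<forall>V\<in>N. \<forall>W\<in>N. X closure_of V \<subseteq> W \<longrightarrow> handled S V W)"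

lemma handled_mono: "handled S V W \<Longrightarrow> S \<subseteq> S' \<Longrightarrow> handled S' V W"
  unfolding handled_def by (meson Range_mono subsetD)

lemma settled_mono: "settled S N \<Longrightarrow> S \<subseteq> S' \<Longrightarrow> settled S' N"
  unfolding settled_def using handled_mono by blast

lemma selection_empty: "selection {}"
  by (simp add: selection_def)

lemma selection_Union:
  assumes chain: "\<And>S S'. S \<in> \<C> \<Longrightarrow> S' \<in> \<C> \<Longrightarrow> extends S S' \<or> extends S' S"
    and sel: "\<And>S. S \<in> \<C> \<Longrightarrow> selection S"
  shows "selection (\<Union>\<C>)"
proof -
  have "finite ((\<Union>\<C>) `` {W})" for W
  proof (cases "W \<in> Domain (\<Union>\<C>)")
    case True
    then obtain S where S: "S \<in> \<C>" "W \<in> Domain S"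
      by blast
    then have "(\<Union>\<C>) `` {W} = S `` {W}"
      using extends_Union[OF chain S(1)] unfolding extends_def by blast
    then show ?thesis
      using sel[OF S(1)] by (simp add: selection_def)
  next
    case False
    then have "(\<Union>\<C>) `` {W} = {}"
      by blast
    then show ?thesis
      by simp
  qed
  then show ?thesis
    using sel unfolding selection_def by blast
qed

text \<open>The reason why the construction never gets stuck. If every member of \<open>\<B>\<close> between \<open>p\<close> and \<open>W\<close>
  were in \<open>\<Union>\<N> \<union> F\<close>, then some \<open>N \<in> \<N>\<close> would contain a local base at \<open>p\<close>. Otherwise each \<open>N \<in> \<N>\<close> fails
  inside some neighbourhood of \<open>p\<close>, and as \<open>p\<close> is not isolated, the intersection of these finitely many
  neighbourhoods can be shrunk so that it contains no \<open>W' \<in> F\<close> around \<open>p\<close> either. Two members \<open>W0, W1\<close> of this local base with \<open>closure W0 \<subseteq> W1 \<subseteq> W\<close> form a pair of the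
  settled set \<open>N\<close>, so \<open>p\<close> already lies in a new set inside \<open>W\<close>.\<close>

lemma fresh_member:
  assumes fin: "finite \<N>" "finite F"
    and settled: "\<And>N. N \<in> \<N> \<Longrightarrow> settled S N"
    and W: "openin X W" "p \<in> W"
    and p: "\<not> openin X {p}" "\<And>R. R \<in> Range S \<Longrightarrow> p \<in> R \<Longrightarrow> \<not> R \<subseteq> W"
  obtains W' where "W' \<in> \<B>" "p \<in> W'" "W' \<subseteq> W" "W' \<notin> \<Union>\<N> \<union> F"
proof -
  have "\<exists>U. openin X U \<and> p \<in> U \<and> U \<subseteq> W \<and> (\<forall>W'\<in>\<B> \<inter> N. p \<in> W' \<longrightarrow> \<not> W' \<subseteq> U)"
    if N: "N \<in> \<N>" for N
  proof (rule ccontr)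
    assume "\<not> ?thesis"
    then have local_base: "\<exists>W'\<in>\<B> \<inter> N. p \<in> W' \<and> W' \<subseteq> U" if "openin X U" "p \<in> U" "U \<subseteq> W" for U
      using that by blast
    obtain W1 where W1: "W1 \<in> \<B> \<inter> N" "p \<in> W1" "W1 \<subseteq> W"
      using local_base[OF W order_refl] by auto
    obtain R where R: "openin X R" "p \<in> R" "X closure_of R \<subseteq> W1"
      by (rule regular_open_between[OF regular base_open[OF IntD1[OF W1(1)]] W1(2)])
    have "R \<subseteq> W"
      using closure_of_subset[OF openin_subset[OF R(1)]] R(3) W1(3) by blast
    then obtain W0 where W0: "W0 \<in> \<B> \<inter> N" "p \<in> W0" "W0 \<subseteq> R"
      using local_base[OF R(1,2)] by auto
    have "X closure_of W0 \<subseteq> W1"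
      using closure_of_mono[OF W0(3), of X] R(3) by (rule order_trans)
    then have "handled S W0 W1"
      using settled[OF N] W0(1) W1(1) unfolding settled_def by blast
    moreover have "p \<in> X closure_of W0"
      using closure_of_subset[OF openin_subset[OF base_open[OF IntD1[OF W0(1)]]]] W0(2) by blast
    ultimately show False
      using p W1(3) unfolding handled_def by (meson order_trans)
  qed
  then have "\<exists>U. \<forall>N\<in>\<N>. openin X (U N) \<and> p \<in> U N \<and> (\<forall>W'\<in>\<B> \<inter> N. p \<in> W' \<longrightarrow> \<not> W' \<subseteq> U N)"
    by (intro bchoice) blast
  then obtain U where U: "\<And>N. N \<in> \<N> \<Longrightarrow> openin X (U N)" "\<And>N. N \<in> \<N> \<Longrightarrow> p \<in> U N"
      "\<And>N W'. N \<in> \<N> \<Longrightarrow> W' \<in> \<B> \<inter> N \<Longrightarrow> p \<in> W' \<Longrightarrow> \<not> W' \<subseteq> U N"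
    by blast
  \<comment> \<open>Removing one further point of each member of \<open>F\<close> excludes that member.\<close>
  let ?G = "{W'\<in>F \<inter> \<B>. p \<in> W'}"
  have "\<exists>q. q \<in> W' \<and> q \<noteq> p" if "W' \<in> ?G" for W'
  proof (rule ccontr)
    assume "\<not> ?thesis"
    then have "W' = {p}"
      using that by blast
    then show False
      using p(1) base_open that by blast
  qed
  then have "\<exists>q. \<forall>W'\<in>?G. q W' \<in> W' \<and> q W' \<noteq> p"
    by (intro bchoice) blast
  then obtain q where q: "\<And>W'. W' \<in> ?G \<Longrightarrow> q W' \<in> W' \<and> q W' \<noteq> p"
    by blast
  let ?O = "(W \<inter> \<Inter>(insert (topspace X) (U ` \<N>))) - q ` ?G"
  have "openin X (\<Inter>(insert (topspace X) (U ` \<N>)))"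
    using fin(1) U(1) by (intro openin_Inter) auto
  moreover have "q ` ?G \<subseteq> topspace X"
    using q openin_subset[OF base_open] by blast
  then have "closedin X (q ` ?G)"
    using fin(2) Hausdorff by (simp add: closedin_Hausdorff_finite)
  ultimately have "openin X ?O"
    using W(1) by (intro openin_diff openin_Int)
  moreover have "p \<in> ?O"
    using W U(2) q openin_subset[OF W(1)] by blast
  ultimately obtain W' where W': "W' \<in> \<B>" "p \<in> W'" "W' \<subseteq> ?O"
    by (rule base_inside)
  have "W' \<notin> N" if "N \<in> \<N>" for N
    using U(3)[OF that, of W'] W' that by blast
  moreover have "W' \<notin> F"
    using q[of W'] W' by blast
  ultimately show thesis
    using that[of W'] W' by blast
qed

text \<open>Only finitely many new sets are added, by compactness of the closure of \<open>V\<close>. The finite set \<open>F\<close>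
  collects the members of \<open>\<B>\<close> used outside the settled sets in \<open>\<N>\<close>.\<close>

lemma handle_pair:
  assumes S: "selection S" "Domain S \<subseteq> \<Union>\<N> \<union> F"
    and fin: "finite \<N>" "finite F"
    and settled: "\<And>N. N \<in> \<N> \<Longrightarrow> settled S N"
    and VW: "openin X W" "X closure_of V \<subseteq> W"
  obtains S' F' where "selection S'" "extends S S'" "handled S' V W" "finite F'" "F \<subseteq> F'"
    "F' \<subseteq> F \<union> \<B>" "Domain S' \<subseteq> \<Union>\<N> \<union> F'"
proof -
  define new where "new = {R. openin X R \<and> X interior_of (X closure_of R) = R \<and>
     (\<exists>W'\<in>\<B> - (\<Union>\<N> \<union> F). R \<subseteq> W' \<and> W' \<subseteq> W)}"
  define old where "old = {R\<in>Range S. R \<subseteq> W} \<union> {{p} |p. openin X {p}}"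
  have "X closure_of V \<subseteq> \<Union>(old \<union> new)"
  proof
    fix p assume "p \<in> X closure_of V"
    then have pW: "p \<in> W"
      using VW(2) by blast
    show "p \<in> \<Union>(old \<union> new)"
    proof (cases "openin X {p} \<or> (\<exists>R\<in>Range S. p \<in> R \<and> R \<subseteq> W)")
      case True
      then show ?thesis
        unfolding old_def by blast
    next
      case False
      then have uncovered: "\<not> openin X {p}" "\<And>R. R \<in> Range S \<Longrightarrow> p \<in> R \<Longrightarrow> \<not> R \<subseteq> W"
        by blast+
      obtain W' where W': "W' \<in> \<B>" "p \<in> W'" "W' \<subseteq> W" "W' \<notin> \<Union>\<N> \<union> F"
        by (rule fresh_member[OF fin settled VW(1) pW uncovered])
      obtain R where R: "openin X R" "X interior_of (X closure_of R) = R" "p \<in> R"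
          "X closure_of R \<subseteq> W'"
        by (rule regular_open_between[OF regular base_open[OF W'(1)] W'(2)])
      have "R \<subseteq> W'"
        using closure_of_subset[OF openin_subset[OF R(1)]] R(4) by (rule order_trans)
      with R(1,2) W' have "R \<in> new"
        unfolding new_def by blast
      then show ?thesis
        using R(3) by blast
    qed
  qed
  moreover have "compactin X (X closure_of V)"
    by (intro closedin_compact_space compact closedin_closure_of)
  moreover have "openin X R" if "R \<in> old \<union> new" for R
    using that S(1) unfolding selection_def old_def new_def by blast
  ultimately have "\<exists>\<F>. finite \<F> \<and> \<F> \<subseteq> old \<union> new \<and> X closure_of V \<subseteq> \<Union>\<F>"
    by (intro compactinD)
  then obtain \<F> where \<F>: "finite \<F>" "\<F> \<subseteq> old \<union> new" "X closure_of V \<subseteq> \<Union>\<F>"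
    by blast
  have "\<exists>w. \<forall>R\<in>\<F> \<inter> new. w R \<in> \<B> - (\<Union>\<N> \<union> F) \<and> R \<subseteq> w R \<and> w R \<subseteq> W"
    unfolding new_def by (intro bchoice) blast
  then obtain w where "\<forall>R\<in>\<F> \<inter> new. w R \<in> \<B> - (\<Union>\<N> \<union> F) \<and> R \<subseteq> w R \<and> w R \<subseteq> W"
    by (rule exE)
  note w = bspec[OF this]
  define S1 where "S1 = (\<lambda>R. (w R, R)) ` (\<F> \<inter> new)"
  have S1: "R \<in> \<F> \<inter> new \<and> W' = w R" if "(W', R) \<in> S1" for W' R
    using that by (auto simp: S1_def)
  have fin1: "finite S1"
    using \<F>(1) by (simp add: S1_def)
  have sel1: "W' \<in> \<B> \<and> R \<subseteq> W' \<and> openin X R \<and> X interior_of (X closure_of R) = R"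
    "W' \<notin> Domain S" if "(W', R) \<in> S1" for W' R
    using S1[OF that] w[of R] S(2) unfolding new_def by auto
  have fib: "finite ((S \<union> S1) `` {W'})" for W'
  proof -
    have "finite (S1 `` {W'})"
      by (rule finite_Image) (rule fin1)
    then show ?thesis
      using S(1) by (simp add: selection_def Un_Image)
  qed
  have "selection (S \<union> S1)"
    using S(1) sel1(1) fib unfolding selection_def by auto
  moreover have "extends S (S \<union> S1)"
    using sel1(2) unfolding extends_def by blast
  moreover have "handled (S \<union> S1) V W"
    unfolding handled_def
  proof
    fix p assume "p \<in> X closure_of V"
    then obtain R where R: "R \<in> \<F>" "p \<in> R"
      using \<F>(3) by blast
    show "openin X {p} \<or> (\<exists>R\<in>Range (S \<union> S1). p \<in> R \<and> R \<subseteq> W)"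
    proof (cases "R \<in> new")
      case True
      then have "(w R, R) \<in> S1" "R \<subseteq> W"
        using R w[of R] unfolding S1_def by auto
      then show ?thesis
        using R(2) by blast
    next
      case False
      then have "R \<in> old"
        using R(1) \<F>(2) by blast
      then show ?thesis
        using R(2) unfolding old_def by blast
    qed
  qed
  moreover have "finite (F \<union> Domain S1)"
    using fin(2) fin1 by (simp add: finite_Domain)
  moreover have "F \<subseteq> F \<union> Domain S1"
    by simp
  moreover have "F \<union> Domain S1 \<subseteq> F \<union> \<B>"
    using sel1(1) by blast
  moreover have "Domain (S \<union> S1) \<subseteq> \<Union>\<N> \<union> (F \<union> Domain S1)"
    using S(2) by auto
  ultimately show thesis
    by (rule that)
qed

lemma handle_finite:
  assumes "finite P" "selection S" "Domain S \<subseteq> \<Union>\<N> \<union> F"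
    and "finite \<N>" "finite F" "\<And>N. N \<in> \<N> \<Longrightarrow> settled S N"
    and "\<And>V W. (V, W) \<in> P \<Longrightarrow> openin X W \<and> X closure_of V \<subseteq> W"
  shows "\<exists>S' F'. selection S' \<and> extends S S' \<and> (\<forall>(V, W)\<in>P. handled S' V W) \<and> finite F' \<and>
    F \<subseteq> F' \<and> F' \<subseteq> F \<union> \<B> \<and> Domain S' \<subseteq> \<Union>\<N> \<union> F'"
  using assms(1,7)
proof (induction P)
  case empty
  then show ?case
    using assms(2,3,5) by (intro exI[of _ S] exI[of _ F]) simp
next
  case (insert x P)
  obtain V W where x: "x = (V, W)"
    by force
  have "\<exists>S1 F1. selection S1 \<and> extends S S1 \<and> (\<forall>(V, W)\<in>P. handled S1 V W) \<and> finite F1 \<and>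
      F \<subseteq> F1 \<and> F1 \<subseteq> F \<union> \<B> \<and> Domain S1 \<subseteq> \<Union>\<N> \<union> F1"
    by (rule insert.IH) (rule insert.prems, rule insertI2)
  then obtain S1 F1 where 1: "selection S1" "extends S S1" "\<forall>(V, W)\<in>P. handled S1 V W" "finite F1"
      "F \<subseteq> F1" "F1 \<subseteq> F \<union> \<B>" "Domain S1 \<subseteq> \<Union>\<N> \<union> F1"
    by (elim exE conjE)
  have settled1: "\<And>N. N \<in> \<N> \<Longrightarrow> settled S1 N"
    using assms(6) settled_mono extends_subset[OF 1(2)] by blast
  have VW: "openin X W" "X closure_of V \<subseteq> W"
    using insert.prems[of V W] x by auto
  obtain S2 F2 where 2: "selection S2" "extends S1 S2" "handled S2 V W" "finite F2"
      "F1 \<subseteq> F2" "F2 \<subseteq> F1 \<union> \<B>" "Domain S2 \<subseteq> \<Union>\<N> \<union> F2"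
    by (rule handle_pair[OF 1(1,7) assms(4) 1(4) settled1 VW])
  have "handled S2 V' W'" if "(V', W') \<in> P" for V' W'
    using 1(3) that handled_mono[OF _ extends_subset[OF 2(2)]] by blast
  then have "\<forall>(V, W)\<in>insert x P. handled S2 V W"
    using 2(3) x by auto
  moreover have "extends S S2"
    using 1(2) 2(2) by (rule extends_trans)
  moreover have "F \<subseteq> F2" "F2 \<subseteq> F \<union> \<B>"
    using 1(5,6) 2(5,6) by auto
  ultimately show ?case
    using 2(1,4,7) by (intro exI[of _ S2] exI[of _ F2] conjI)
qed

text \<open>The pairs to be handled multiply along the way, because all members of \<open>\<B>\<close> used have to enter
  the settled set. Therefore the settled set is built from finite approximations: stage \<open>n\<close> handles
  all pairs of the current finite set \<open>F\<close>, and then adds the members just used together with the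
  \<open>n\<close>-th element of \<open>E\<close>. After finitely many steps the members used exceed \<open>\<Union>\<N>\<close> by a finite set only,
  as \<open>fresh_member\<close> requires.\<close>

lemma settle_countable:
  assumes S: "selection S" "Domain S \<subseteq> \<Union>\<N>"
    and fin: "finite \<N>"
    and settled: "\<And>N. N \<in> \<N> \<Longrightarrow> settled S N"
    and E: "countable E" "E \<subseteq> \<B>"
  shows "\<exists>S' N. selection S' \<and> extends S S' \<and> settled S' N \<and> E \<subseteq> N \<and> N \<subseteq> \<B> \<and> countable N \<and>
    Domain S' \<subseteq> \<Union>\<N> \<union> N"
proof -
  \<comment> \<open>At most one element; working with sets avoids a separate case for finite or empty \<open>E\<close>.\<close>
  define e where "e n = {W \<in> E. to_nat_on E W = n}" for n
  have e: "finite (e n)" "e n \<subseteq> E" for n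
  proof -
    show "e n \<subseteq> E"
      by (auto simp: e_def)
    have "e n \<subseteq> {from_nat_into E n}"
      using E(1) by (auto simp: e_def)
    then show "finite (e n)"
      by (rule finite_subset) simp
  qed
  have Ee: "E = (\<Union>n. e n)"
    by (auto simp: e_def)
  define ok where "ok n T F \<longleftrightarrow> selection T \<and> extends S T \<and> finite F \<and> F \<subseteq> \<B> \<and>
    Domain T \<subseteq> \<Union>\<N> \<union> F" for n :: nat and T F
  define step where "step n T F T' F' \<longleftrightarrow> extends T T' \<and> F \<union> e n \<subseteq> F' \<and> settled T' F"
    for n T F T' F'
  have "\<exists>f. \<forall>n. (case f n of (T, F) \<Rightarrow> ok n T F) \<and>
      (case f n of (T, F) \<Rightarrow> case f (Suc n) of (T', F') \<Rightarrow> step n T F T' F')"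
  proof (rule dependent_nat_choice)
    show "\<exists>x. case x of (T, F) \<Rightarrow> ok 0 T F"
      using S by (intro exI[of _ "(S, {})"]) (auto simp: ok_def)
  next
    fix x n assume "case x of (T, F) \<Rightarrow> ok n T F"
    then obtain T F where x: "x = (T, F)" and "ok n T F"
      by (cases x) auto
    then have T: "selection T" "extends S T" "finite F" "F \<subseteq> \<B>" "Domain T \<subseteq> \<Union>\<N> \<union> F"
      by (auto simp: ok_def)
    let ?P = "{(V, W). V \<in> F \<and> W \<in> F \<and> X closure_of V \<subseteq> W}"
    have "finite ?P"
      by (rule finite_subset[of _ "F \<times> F"]) (use T(3) in auto)
    moreover have "\<And>N. N \<in> \<N> \<Longrightarrow> settled T N"
      using settled settled_mono extends_subset[OF T(2)] by blast
    moreover have "\<And>V W. (V, W) \<in> ?P \<Longrightarrow> openin X W \<and> X closure_of V \<subseteq> W"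
      using T(4) base_open by blast
    ultimately have "\<exists>T' F'. selection T' \<and> extends T T' \<and> (\<forall>(V, W)\<in>?P. handled T' V W) \<and>
        finite F' \<and> F \<subseteq> F' \<and> F' \<subseteq> F \<union> \<B> \<and> Domain T' \<subseteq> \<Union>\<N> \<union> F'"
      using T(1,3,5) fin by (intro handle_finite)
    then obtain T' F' where T': "selection T'" "extends T T'" "\<forall>(V, W)\<in>?P. handled T' V W"
        "finite F'" "F \<subseteq> F'" "F' \<subseteq> F \<union> \<B>" "Domain T' \<subseteq> \<Union>\<N> \<union> F'"
      by (elim exE conjE)
    have "settled T' F"
      using T'(3) unfolding settled_def by blast
    moreover have "extends S T'"
      using T(2) T'(2) by (rule extends_trans)
    ultimately have "ok (Suc n) T' (F' \<union> e n)" "step n T F T' (F' \<union> e n)"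
      using T' T(4) e[of n] E(2) unfolding ok_def step_def by auto
    then show "\<exists>y. (case y of (T, F) \<Rightarrow> ok (Suc n) T F) \<and>
        (case x of (T, F) \<Rightarrow> case y of (T', F') \<Rightarrow> step n T F T' F')"
      using x by (intro exI[of _ "(T', F' \<union> e n)"]) simp
  qed
  then obtain f where f: "\<And>n. ok n (fst (f n)) (snd (f n))"
      "\<And>n. step n (fst (f n)) (snd (f n)) (fst (f (Suc n))) (snd (f (Suc n)))"
    by (auto simp: case_prod_beta)
  let ?T = "\<lambda>n. fst (f n)" and ?F = "\<lambda>n. snd (f n)"
  have extT: "extends (?T m) (?T n)" if "m \<le> n" for m n
    using that
  proof (induction n rule: dec_induct)
    case (step n)
    then show ?case
      using f(2)[of n] extends_trans unfolding step_def by blast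
  qed simp
  have monoF: "?F m \<subseteq> ?F n" if "m \<le> n" for m n
    using that
  proof (induction n rule: dec_induct)
    case (step n)
    then show ?case
      using f(2)[of n] unfolding step_def by blast
  qed simp
  have chain: "extends U U' \<or> extends U' U" if "U \<in> range ?T" "U' \<in> range ?T" for U U'
    using that extT nat_le_linear by (metis (no_types, lifting) rangeE)
  let ?S = "\<Union>(range ?T)" and ?N = "\<Union>(range ?F)"
  have extS: "extends (?T n) ?S" for n
    by (rule extends_Union[OF chain]) auto
  have "selection ?S"
    using f(1) by (intro selection_Union[OF chain]) (auto simp: ok_def)
  moreover have "extends S ?S"
    using f(1)[of 0] extS[of 0] extends_trans unfolding ok_def by blast
  moreover have "settled ?S ?N"
    unfolding settled_def
  proof (intro ballI impI)
    fix V W assume VW: "V \<in> ?N" "W \<in> ?N" "X closure_of V \<subseteq> W"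
    then obtain m n where "V \<in> ?F m" "W \<in> ?F n"
      by blast
    then have "V \<in> ?F (max m n)" "W \<in> ?F (max m n)"
      using monoF[of m "max m n"] monoF[of n "max m n"] by auto
    then have "handled (?T (Suc (max m n))) V W"
      using f(2)[of "max m n"] VW(3) unfolding step_def settled_def by blast
    then show "handled ?S V W"
      by (rule handled_mono) blast
  qed
  moreover have "E \<subseteq> ?N"
    using f(2) unfolding Ee step_def by blast
  moreover have "?N \<subseteq> \<B>"
    using f(1) unfolding ok_def by blast
  moreover have "countable ?N"
    using f(1) unfolding ok_def by (auto intro: countable_finite)
  moreover have "Domain ?S \<subseteq> \<Union>\<N> \<union> ?N"
  proof
    fix W assume "W \<in> Domain ?S"
    then obtain n where "W \<in> Domain (?T n)"
      by blast
    then show "W \<in> \<Union>\<N> \<union> ?N"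
      using f(1)[of n] unfolding ok_def by blast
  qed
  ultimately show ?thesis
    by blast
qed

text \<open>An uncountable \<open>E\<close> is exhausted by a chain of smaller settled sets. The statement carries an
  arbitrary finite family \<open>\<N>\<close> of sets settled before, since the uncountable case applies the
  induction hypothesis with one more such set. The bound on \<open>|N|\<close> is what keeps the unions of initial
  parts of the chain smaller than \<open>E\<close>.\<close>

lemma settle:
  fixes E :: "'a set set"
  assumes "selection S" "Domain S \<subseteq> \<Union>\<N>" "finite \<N>" "\<And>N. N \<in> \<N> \<Longrightarrow> settled S N" "E \<subseteq> \<B>"
  shows "\<exists>S' N. selection S' \<and> extends S S' \<and> settled S' N \<and> E \<subseteq> N \<and> N \<subseteq> \<B> \<and>
    |N| \<le>o |E <+> (UNIV :: nat set)| \<and> Domain S' \<subseteq> \<Union>\<N> \<union> N"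
  using assms
proof (induction "|E|" arbitrary: E S \<N> rule: wf_induct_rule[OF wf_ordLess])
  case (1 E S0 \<N>)
  note IH = 1(1) and S0 = 1(2,3) and fin = 1(4) and settled = 1(5) and EB = 1(6)
  show ?case
  proof (cases "countable E")
    case True
    then obtain S' N where S': "selection S'" "extends S0 S'" "settled S' N" "E \<subseteq> N" "N \<subseteq> \<B>"
        "countable N" "Domain S' \<subseteq> \<Union>\<N> \<union> N"
      using settle_countable[OF S0 fin settled True EB] by blast
    have "|N| \<le>o |UNIV :: nat set|"
      using S'(6) countable_card_of_nat by blast
    also have "|UNIV :: nat set| \<le>o |E <+> (UNIV :: nat set)|"
      by (rule card_of_Plus2)
    finally show ?thesis
      using S' by blast
  next
    case False
    \<comment> \<open>\<open>r\<close> well-orders \<open>E\<close> such that all proper initial segments are smaller than \<open>E\<close>.\<close>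
    define r where "r = |E|"
    have r: "Card_order r" "Well_order r" "Field r = E"
      unfolding r_def by (rule card_of_Card_order card_of_Well_order Field_card_of)+
    have total: "d = d' \<or> d \<in> underS r d' \<or> d' \<in> underS r d" if "d \<in> E" "d' \<in> E" for d d'
      using r(2,3) that unfolding well_order_on_def linear_order_on_def total_on_def underS_def by blast
    have underS_E: "underS r e \<subseteq> E" for e
      using r(3) by (auto simp: underS_def Field_def)
    have underS_trans: "underS r d \<subseteq> underS r e" if "d \<in> underS r e" for d e
      using r(2) that
      unfolding well_order_on_def linear_order_on_def partial_order_on_def preorder_on_def
        underS_def trans_def antisym_def by blast
    let ?Z = "\<lambda>e. underS r e <+> (UNIV :: nat set)"
    let ?T = "\<lambda>g I. \<Union>(insert S0 ((\<lambda>d. fst (g d)) ` I)) :: ('a set \<times> 'a set) set"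
    let ?M = "\<lambda>g I. \<Union>((\<lambda>d. snd (g d)) ` I) :: 'a set set"
    \<comment> \<open>\<open>g\<close> sends each stage \<open>e\<close> to its assignment and its settled set, \<open>?T g I\<close> and \<open>?M g I\<close> are the unions
      over the stages in \<open>I\<close>, and \<open>ok g e x\<close> says that \<open>x\<close> is a correct stage \<open>e\<close> after the earlier
      stages given by \<open>g\<close>.\<close>
    define ok where "ok g e x \<longleftrightarrow> (e \<in> E \<longrightarrow> selection (fst x) \<and>
        extends (?T g (underS r e)) (fst x) \<and> settled (fst x) (snd x) \<and>
        insert e (?M g (underS r e)) \<subseteq> snd x \<and> snd x \<subseteq> \<B> \<and> |snd x| \<le>o |?Z e| \<and>
        Domain (fst x) \<subseteq> \<Union>\<N> \<union> snd x)"
      for g :: "'a set \<Rightarrow> ('a set \<times> 'a set) set \<times> 'a set set" and e x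
    have wfr: "wf (r - Id)"
      using r(2) by (simp add: well_order_on_def)
    \<comment> \<open>The stages increase, so the union over an initial segment is an end extension of each of them, and any
      two elements of \<open>?M g I\<close> already lie in the settled set of a single stage.\<close>
    have union: "selection (?T g I) \<and> extends S0 (?T g I) \<and> settled (?T g I) (?M g I) \<and>
        Domain (?T g I) \<subseteq> \<Union>\<N> \<union> ?M g I \<and> ?M g I \<subseteq> \<B>"
      if I: "I \<subseteq> E" "\<And>d. d \<in> I \<Longrightarrow> underS r d \<subseteq> I" and ok: "\<And>d. d \<in> I \<Longrightarrow> ok g d (g d)" for g I
    proof -
      have okI: "selection (fst (g d))" "extends (?T g (underS r d)) (fst (g d))"
        "settled (fst (g d)) (snd (g d))" "insert d (?M g (underS r d)) \<subseteq> snd (g d)"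
        "snd (g d) \<subseteq> \<B>" "Domain (fst (g d)) \<subseteq> \<Union>\<N> \<union> snd (g d)" if "d \<in> I" for d
        using ok[OF that] that I(1) unfolding ok_def by auto
      have ext: "extends S0 (fst (g e)) \<and> (\<forall>d\<in>underS r e. extends (fst (g d)) (fst (g e)))"
        if "e \<in> I" for e
        using that
      proof (induction e rule: wf_induct_rule[OF wfr])
        case (1 e)
        have IHe: "extends S0 (fst (g d))"
            "\<And>d'. d' \<in> underS r d \<Longrightarrow> extends (fst (g d')) (fst (g d))" if "d \<in> underS r e" for d
          using 1(1)[of d] that I(2)[OF 1(2)] by (auto simp: underS_def)
        have chain: "extends U U' \<or> extends U' U"
          if U: "U \<in> insert S0 ((\<lambda>d. fst (g d)) ` underS r e)" "U' \<in> insert S0 ((\<lambda>d. fst (g d)) ` underS r e)" for U U'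
        proof -
          have comparable: "extends (fst (g d)) (fst (g d')) \<or> extends (fst (g d')) (fst (g d))"
            if "d \<in> underS r e" "d' \<in> underS r e" for d d'
            using total[of d d'] IHe(2) that underS_E[of e] by (metis extends_refl subsetD)
          show ?thesis
            by (rule extends_chain_insert[OF IHe(1) comparable U])
        qed
        have "extends U (fst (g e))" if "U \<in> insert S0 ((\<lambda>d. fst (g d)) ` underS r e)" for U
          using extends_Union[OF chain that] okI(2)[OF 1(2)] by (rule extends_trans)
        then show ?case
          by blast
      qed
      have chain: "extends U U' \<or> extends U' U"
        if U: "U \<in> insert S0 ((\<lambda>d. fst (g d)) ` I)" "U' \<in> insert S0 ((\<lambda>d. fst (g d)) ` I)" for U U'
      proof -
        have comparable: "extends (fst (g d)) (fst (g d')) \<or> extends (fst (g d')) (fst (g d))"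
          if "d \<in> I" "d' \<in> I" for d d'
          using total[of d d'] ext that I(1) by (metis extends_refl subsetD)
        show ?thesis
          by (rule extends_chain_insert[OF conjunct1[OF ext] comparable U])
      qed
      have "selection (?T g I)"
        using S0(1) okI(1) by (intro selection_Union[OF chain]) auto
      moreover have "extends S0 (?T g I)"
        by (rule extends_Union[OF chain]) auto
      moreover have "settled (?T g I) (?M g I)"
        unfolding settled_def
      proof (intro ballI impI)
        fix V W assume VW: "V \<in> ?M g I" "W \<in> ?M g I" "X closure_of V \<subseteq> W"
        then obtain d d' where d: "d \<in> I" "d' \<in> I" "V \<in> snd (g d)" "W \<in> snd (g d')"
          by blast
        have mono: "snd (g c) \<subseteq> snd (g c')" if "c \<in> underS r c'" "c' \<in> I" for c c'
          using okI(4)[OF that(2)] that(1) by blast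
        have "\<exists>c\<in>I. V \<in> snd (g c) \<and> W \<in> snd (g c)"
          using total[of d d'] d I(1) mono by (metis subsetD)
        then obtain c where c: "c \<in> I" "V \<in> snd (g c)" "W \<in> snd (g c)"
          by blast
        then have "handled (fst (g c)) V W"
          using okI(3)[OF c(1)] VW(3) unfolding settled_def by blast
        then show "handled (?T g I) V W"
          by (rule handled_mono) (use c(1) in blast)
      qed
      moreover have "Domain (?T g I) \<subseteq> \<Union>\<N> \<union> ?M g I"
      proof
        fix W assume "W \<in> Domain (?T g I)"
        then consider "W \<in> Domain S0" | d where "d \<in> I" "W \<in> Domain (fst (g d))"
          by blast
        then show "W \<in> \<Union>\<N> \<union> ?M g I"
          using S0(2) okI(6) by cases blast+
      qed
      moreover have "?M g I \<subseteq> \<B>"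
        using okI(5) by blast
      ultimately show ?thesis
        by blast
    qed
    have "\<exists>g. \<forall>e. ok g e (g e)"
    proof (rule dependent_wf_choice[OF wfr])
      fix g h :: "'a set \<Rightarrow> ('a set \<times> 'a set) set \<times> 'a set set" and e x
      assume "\<And>z. (z, e) \<in> r - Id \<Longrightarrow> g z = h z"
      then have "g d = h d" if "d \<in> underS r e" for d
        using that by (auto simp: underS_def)
      then show "ok g e x = ok h e x"
        unfolding ok_def by simp
    next
      fix e g assume "\<And>d. (d, e) \<in> r - Id \<Longrightarrow> ok g d (g d)"
      then have ok: "\<And>d. d \<in> underS r e \<Longrightarrow> ok g d (g d)"
        by (auto simp: underS_def)
      show "\<exists>x. ok g e x"
      proof (cases "e \<in> E")
        case e: True
        let ?T' = "?T g (underS r e)" and ?M' = "?M g (underS r e)"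
        have u: "selection ?T'" "extends S0 ?T'" "settled ?T' ?M'" "Domain ?T' \<subseteq> \<Union>\<N> \<union> ?M'" "?M' \<subseteq> \<B>"
          using union[of "underS r e" g, OF underS_E underS_trans ok] by blast+
        have "|?M'| \<le>o |?Z e|"
        proof -
          have "|snd (g d)| \<le>o |?Z e|" if d: "d \<in> underS r e" for d
          proof -
            have "|snd (g d)| \<le>o |?Z d|"
              using ok[OF d] d underS_E unfolding ok_def by blast
            also have "|?Z d| \<le>o |?Z e|"
              by (intro card_of_mono1) (use underS_trans[OF d] in auto)
            finally show ?thesis .
          qed
          moreover have "|underS r e| \<le>o |?Z e|"
            by (rule card_of_Plus1)
          ultimately have "|\<Union>d\<in>underS r e. snd (g d)| \<le>o |?Z e|"
            by (intro card_of_UNION_ordLeq_infinite) auto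
          then show ?thesis .
        qed
        moreover have "|{e}| \<le>o |?Z e|"
          by (rule card_of_singl_ordLeq) auto
        moreover have Z: "infinite (Field |?Z e| )" "Card_order |?Z e|"
          by (simp add: Field_card_of) (rule card_of_Card_order)
        ultimately have "|{e} \<union> ?M'| \<le>o |?Z e|"
          by (intro card_of_Un_ordLeq_infinite_Field)
        then have M: "|insert e ?M'| \<le>o |?Z e|"
          by simp
        have "|?Z e| <o |E|"
        proof (rule card_of_Plus_ordLess_infinite)
          show "infinite E"
            using False countable_finite by blast
          show "|underS r e| <o |E|"
            using card_of_underS[OF r(1)] e r(3) by (simp add: r_def)
          show "|UNIV :: nat set| <o |E|"
            using False not_ordLeq_iff_ordLess[OF card_of_Well_order card_of_Well_order, of E "UNIV :: nat set"]
            by (simp add: countable_card_of_nat)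
        qed
        with M have "|insert e ?M'| <o |E|"
          by (rule ordLeq_ordLess_trans)
        \<comment> \<open>The union of the earlier stages is settled and serves as one further member of \<open>\<N>\<close>. The new settled set
          contains it, so that \<open>\<N>\<close> does not grow from stage to stage.\<close>
        moreover have "settled ?T' N" if "N \<in> insert ?M' \<N>" for N
          using that settled settled_mono[OF _ extends_subset[OF u(2)]] u(3) by blast
        moreover have "Domain ?T' \<subseteq> \<Union>(insert ?M' \<N>)"
          using u(4) by auto
        moreover have "insert e ?M' \<subseteq> \<B>"
          using u(5) e EB by blast
        ultimately have "\<exists>S' N. selection S' \<and> extends ?T' S' \<and> settled S' N \<and>
            insert e ?M' \<subseteq> N \<and> N \<subseteq> \<B> \<and> |N| \<le>o |insert e ?M' <+> (UNIV :: nat set)| \<and>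
            Domain S' \<subseteq> \<Union>(insert ?M' \<N>) \<union> N"
          using u(1) fin by (intro IH) auto
        then obtain S' N where S': "selection S'" "extends ?T' S'" "settled S' N"
            "insert e ?M' \<subseteq> N" "N \<subseteq> \<B>" "|N| \<le>o |insert e ?M' <+> (UNIV :: nat set)|"
            "Domain S' \<subseteq> \<Union>(insert ?M' \<N>) \<union> N"
          by (elim exE conjE)
        have "|insert e ?M' <+> (UNIV :: nat set)| \<le>o |?Z e|"
          by (rule card_of_Plus_ordLeq_infinite_Field[OF Z(1) M card_of_Plus2 Z(2)])
        with S'(6) have "|N| \<le>o |?Z e|"
          by (rule ordLeq_transitive)
        moreover have "Domain S' \<subseteq> \<Union>\<N> \<union> N"
          using S'(4,7) by blast
        ultimately have "ok g e (S', N)"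
          using S' unfolding ok_def by simp
        then show ?thesis
          by blast
      qed (simp add: ok_def)
    qed
    then obtain g where "\<forall>e. ok g e (g e)"
      by (rule exE)
    note g = spec[OF this]
    have u: "selection (?T g E)" "extends S0 (?T g E)" "settled (?T g E) (?M g E)"
        "Domain (?T g E) \<subseteq> \<Union>\<N> \<union> ?M g E" "?M g E \<subseteq> \<B>"
      using union[OF order_refl underS_E g] by auto
    have "E \<subseteq> ?M g E"
    proof
      fix e assume "e \<in> E"
      then have "e \<in> snd (g e)"
        using g[of e] unfolding ok_def by simp
      with \<open>e \<in> E\<close> show "e \<in> ?M g E"
        by (rule UN_I)
    qed
    moreover have "|?M g E| \<le>o |E <+> (UNIV :: nat set)|"
    proof -
      have "|snd (g d)| \<le>o |E <+> (UNIV :: nat set)|" if d: "d \<in> E" for d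
      proof -
        have "|snd (g d)| \<le>o |?Z d|"
          using g[of d] d unfolding ok_def by blast
        also have "|?Z d| \<le>o |E <+> (UNIV :: nat set)|"
          by (intro card_of_mono1) (use underS_E[of d] in auto)
        finally show ?thesis .
      qed
      moreover have "|E| \<le>o |E <+> (UNIV :: nat set)|"
        by (rule card_of_Plus1)
      ultimately have "|\<Union>d\<in>E. snd (g d)| \<le>o |E <+> (UNIV :: nat set)|"
        by (intro card_of_UNION_ordLeq_infinite) auto
      then show ?thesis .
    qed
    ultimately show ?thesis
      using u by (intro exI conjI)
  qed
qed

end

lemma card_of_UNION_finite_ordLess:
  assumes "Card_order \<kappa>" "cinfinite \<kappa>" "|I| <o \<kappa>" "\<And>i. i \<in> I \<Longrightarrow> finite (A i)"
  shows "|\<Union>i\<in>I. A i| <o \<kappa>"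
proof (cases "finite I")
  case True
  then have "finite (Field |\<Union>i\<in>I. A i| )"
    using assms(4) by (simp add: Field_card_of)
  then show ?thesis
    using assms(1,2) unfolding cinfinite_def card_order_on_def
    by (intro finite_ordLess_infinite card_of_Well_order) auto
next
  case False
  have "|A i| \<le>o |I|" if "i \<in> I" for i
    using False assms(4)[OF that]
    by (intro ordLess_imp_ordLeq finite_ordLess_infinite card_of_Well_order) (simp_all add: Field_card_of)
  then have "|\<Union>i\<in>I. A i| \<le>o |I|"
    using False by (intro card_of_UNION_ordLeq_infinite) (auto intro: card_of_mono1)
  then show ?thesis
    using assms(3) by (rule ordLeq_ordLess_trans)
qed

section \<open>Noetherian type of dense subspaces\<close>

text \<open>Counting the members of the new base above \<open>R\<close> takes place in \<open>\<B>\<close>: they are shrinkings of members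
  of \<open>\<B>\<close> above a fixed nonempty \<open>V \<subseteq> R\<close>, with finitely many shrinkings each. Infinity of \<open>\<kappa>\<close> absorbs
  these finite fibres.\<close>

theorem regular_open_op_like_base:
  assumes "compact_space X" "Hausdorff_space X" "is_base X \<B>" "op_like \<kappa> \<B>"
    and \<kappa>: "Card_order \<kappa>" "cinfinite \<kappa>"
  shows "\<exists>\<R>. is_base X \<R> \<and> op_like \<kappa> \<R> \<and> (\<forall>R\<in>\<R>. X interior_of (X closure_of R) = R)"
proof -
  interpret compact_Hausdorff_base X \<B>
    using assms by unfold_locales
  have "\<exists>S N. selection S \<and> extends {} S \<and> settled S N \<and> \<B> \<subseteq> N \<and> N \<subseteq> \<B> \<and>
      |N| \<le>o |\<B> <+> (UNIV :: nat set)| \<and> Domain S \<subseteq> \<Union>{} \<union> N"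
    by (rule settle) (simp_all add: selection_empty)
  then obtain S N where S: "selection S" "settled S N" "\<B> \<subseteq> N"
    by (elim exE conjE)
  \<comment> \<open>The empty set must be left out: all members of the base lie above it.\<close>
  define \<R> where "\<R> = {R. R \<noteq> {} \<and> (R \<in> Range S \<or> (\<exists>p. R = {p} \<and> openin X {p}))}"
  have open_regular: "openin X R \<and> X interior_of (X closure_of R) = R" if "R \<in> \<R>" for R
  proof (cases "R \<in> Range S")
    case True
    then show ?thesis
      using S(1) unfolding selection_def by blast
  next
    case False
    then obtain p where p: "R = {p}" "openin X {p}"
      using \<open>R \<in> \<R>\<close> unfolding \<R>_def by blast
    then have "p \<in> topspace X"
      using openin_subset by blast
    then have "X closure_of {p} = {p}"
      using Hausdorff by (simp add: closure_of_eq closedin_Hausdorff_singleton)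
    then show ?thesis
      using p by (simp add: interior_of_openin)
  qed
  have "is_base X \<R>"
    unfolding is_base_def
  proof (intro conjI allI impI ballI)
    fix U p assume U: "openin X U \<and> p \<in> U"
    obtain W where W: "W \<in> \<B>" "p \<in> W" "W \<subseteq> U"
      by (rule base_inside[OF conjunct1[OF U] conjunct2[OF U]])
    obtain R where R: "openin X R" "p \<in> R" "X closure_of R \<subseteq> W"
      by (rule regular_open_between[OF regular base_open[OF W(1)] W(2)])
    obtain V where V: "V \<in> \<B>" "p \<in> V" "V \<subseteq> R"
      using base_inside[OF R(1,2)] .
    have "X closure_of V \<subseteq> W"
      using closure_of_mono[OF V(3), of X] R(3) by (rule order_trans)
    then have "handled S V W"
      using S(2,3) V(1) W(1) unfolding settled_def by blast
    moreover have "p \<in> X closure_of V"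
      using closure_of_subset[OF openin_subset[OF base_open[OF V(1)]]] V(2) by blast
    ultimately have "openin X {p} \<or> (\<exists>R\<in>Range S. p \<in> R \<and> R \<subseteq> W)"
      unfolding handled_def by blast
    then show "\<exists>V\<in>\<R>. p \<in> V \<and> V \<subseteq> U"
      using W(2,3) unfolding \<R>_def by blast
  qed (use open_regular in blast)
  moreover have "op_like \<kappa> \<R>"
    unfolding op_like_def
  proof
    fix R assume R: "R \<in> \<R>"
    then obtain p where p: "p \<in> R"
      unfolding \<R>_def by blast
    obtain V where V: "V \<in> \<B>" "p \<in> V" "V \<subseteq> R"
      by (rule base_inside[OF conjunct1[OF open_regular[OF R]] p])
    let ?I = "{W \<in> \<B>. V \<subseteq> W}"
    have "{R' \<in> \<R>. R \<subseteq> R'} \<subseteq> (\<Union>W\<in>?I. insert V (S `` {W}))"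
    proof
      fix R' assume R': "R' \<in> {R' \<in> \<R>. R \<subseteq> R'}"
      then consider W where "(W, R') \<in> S" | q where "R' = {q}"
        unfolding \<R>_def by blast
      then show "R' \<in> (\<Union>W\<in>?I. insert V (S `` {W}))"
      proof cases
        case 1
        then have "W \<in> ?I"
          using S(1) V(3) R' unfolding selection_def by blast
        then show ?thesis
          using 1 by blast
      next
        case 2
        then have "R' = V"
          using V R' by blast
        then show ?thesis
          using V(1) by blast
      qed
    qed
    moreover have "|\<Union>W\<in>?I. insert V (S `` {W})| <o \<kappa>"
      using assms(4) V(1) S(1) unfolding op_like_def selection_def
      by (intro card_of_UNION_finite_ordLess[OF \<kappa>]) auto
    ultimately show "|{R' \<in> \<R>. R \<subseteq> R'}| <o \<kappa>"
      by (rule ordLeq_ordLess_trans[OF card_of_mono1])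
  qed
  ultimately show ?thesis
    using open_regular by (intro exI[of _ \<R>]) simp
qed

lemma is_base_subtopology:
  assumes "is_base X \<B>"
  shows "is_base (subtopology X D) ((\<lambda>U. U \<inter> D) ` \<B>)"
  unfolding is_base_def
proof (intro conjI allI impI ballI)
  fix U p assume "openin (subtopology X D) U \<and> p \<in> U"
  then obtain T where T: "openin X T" "U = T \<inter> D" "p \<in> T" "p \<in> D"
    by (auto simp: openin_subtopology)
  have "\<exists>V\<in>\<B>. p \<in> V \<and> V \<subseteq> T"
    using assms T(1,3) unfolding is_base_def by simp
  then obtain V where V: "V \<in> \<B>" "p \<in> V" "V \<subseteq> T"
    by (elim bexE conjE)
  then have "V \<inter> D \<in> (\<lambda>U. U \<inter> D) ` \<B>" "p \<in> V \<inter> D" "V \<inter> D \<subseteq> U"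
    using T by auto
  then show "\<exists>V\<in>(\<lambda>U. U \<inter> D) ` \<B>. p \<in> V \<and> V \<subseteq> U"
    by (intro bexI conjI)
next
  fix V assume "V \<in> (\<lambda>U. U \<inter> D) ` \<B>"
  then show "openin (subtopology X D) V"
    using assms unfolding is_base_def openin_subtopology by auto
qed

text \<open>A dense set sees the closure of an open set, and a regular open set is determined by its closure.\<close>

lemma regular_open_subset_if_dense_trace:
  assumes "dense_in X D" "openin X R" "X interior_of (X closure_of R') = R'"
    and "R \<inter> D \<subseteq> R'"
  shows "R \<subseteq> R'"
proof -
  have "R \<subseteq> X closure_of R"
    using assms(2) by (simp add: closure_of_subset openin_subset)
  also have "X closure_of R = X closure_of (R \<inter> D)"
    using closure_of_openin_Int_closure_of[OF assms(2), of D] assms(1,2)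
    by (simp add: dense_in_def Int_absorb2 openin_subset)
  also have "\<dots> \<subseteq> X closure_of R'"
    using assms(4) by (rule closure_of_mono)
  finally show ?thesis
    using assms(2,3) interior_of_maximal by metis
qed

lemma Nt_dense_subspace_le:
  assumes "compact_space X" "Hausdorff_space X" "dense_in X D"
  shows "Nt (subtopology X D) \<le>o Nt X"
proof -
  obtain \<B> where "is_base X \<B>" "op_like (Nt X) \<B>"
    using Nt(3) by blast
  then have "\<exists>\<R>. is_base X \<R> \<and> op_like (Nt X) \<R> \<and> (\<forall>R\<in>\<R>. X interior_of (X closure_of R) = R)"
    by (rule regular_open_op_like_base[OF assms(1,2) _ _ Nt(1,2)])
  then obtain \<R> where \<R>: "is_base X \<R>" "op_like (Nt X) \<R>"
    and "\<forall>R\<in>\<R>. X interior_of (X closure_of R) = R"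
    by (elim exE conjE)
  note reg = bspec[OF this(3)]
  have "op_like (Nt X) ((\<lambda>R. R \<inter> D) ` \<R>)"
    unfolding op_like_def
  proof
    fix U assume "U \<in> (\<lambda>R. R \<inter> D) ` \<R>"
    then obtain R where R: "R \<in> \<R>" "U = R \<inter> D"
      by blast
    have "openin X R"
      using \<R>(1) R(1) unfolding is_base_def by simp
    then have "R \<subseteq> R'" if "R' \<in> \<R>" "R \<inter> D \<subseteq> R'" for R'
      using reg[OF that(1)] that(2) by (rule regular_open_subset_if_dense_trace[OF assms(3)])
    then have "{V \<in> (\<lambda>R. R \<inter> D) ` \<R>. U \<subseteq> V} \<subseteq> (\<lambda>R. R \<inter> D) ` {R' \<in> \<R>. R \<subseteq> R'}"
      using R(2) by blast
    then have "|{V \<in> (\<lambda>R. R \<inter> D) ` \<R>. U \<subseteq> V}| \<le>o |(\<lambda>R. R \<inter> D) ` {R' \<in> \<R>. R \<subseteq> R'}|"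
      by (rule card_of_mono1)
    also have "|(\<lambda>R. R \<inter> D) ` {R' \<in> \<R>. R \<subseteq> R'}| \<le>o |{R' \<in> \<R>. R \<subseteq> R'}|"
      by (rule card_of_image)
    also have "|{R' \<in> \<R>. R \<subseteq> R'}| <o Nt X"
      using \<R>(2) R(1) unfolding op_like_def by blast
    finally show "|{V \<in> (\<lambda>R. R \<inter> D) ` \<R>. U \<subseteq> V}| <o Nt X" .
  qed
  then show ?thesis
    using Nt(4)[OF Nt(1,2) is_base_subtopology[OF \<R>(1)]] by blast
qed

theorem corollary2p33:
  fixes X :: "'a topology"
  assumes "compact_space X" and "Hausdorff_space X"
    and "cinfinite (weight X)" and "regularCard (weight X)"
    and "homogeneous_space X
       \<or> hereditarily normal_space X
       \<or> \<not> (\<exists>e. embedding_map beta_omega X e)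
       \<or> |topspace X| <o ctwo ^c weight X"
  shows "delta_Nt X =o Nt X"
proof -
  have "delta_Nt X \<le>o Nt X"
    using Nt_dense_subspace_le[OF assms(1,2)] by (intro delta_Nt(3) Nt(1))
  moreover have "dense_in X (topspace X)"
    by (simp add: dense_in_def)
  then have "Nt X \<le>o delta_Nt X"
    using delta_Nt(2)[of X "topspace X"] by simp
  ultimately show ?thesis
    by (simp add: ordIso_iff_ordLeq)
qed

end
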